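(* Let $k\ge 1$ and $n\ge 3$. In the universal virtual braid group $UV_n(k)$, let $(F1)$ be the family of relations $$\rho_i\sigma_{i+1,t}\sigma_{i,t}=\sigma_{i+1,t}\sigma_{i,t}\rho_{i+1}\qquad (1\le i\le n-2,\ 1\le t\le k)$$ and let $(F2)$ be the family of relations $$\rho_{i+1}\sigma_{i,t}\sigma_{i+1,t}=\sigma_{i,t}\sigma_{i+1,t}\rho_i\qquad (1\le i\le n-2,\ 1\le t\le k).$$ Then the quotients $$Q_1=UV_n(k)/\langle\!\langle F1\rangle\!\rangle\qquad\text{and}\qquad Q_2=UV_n(k)/\langle\!\langle F2\rangle\!\rangle$$ are isomorphic groups.
   Context: The universal virtual braid group $UV_n(k)$ is the group with generators $\rho_i,\sigma_{i,t}$ ($1\le i\le n-1$, $1\le t\le k$) and defining relations: (1) $\rho_i^2=1$; $\rho_i\rho_{i+1}\rho_i=\rho_{i+1}\rho_i\rho_{i+1}$ for $1\le i\le n-2$; $\rho_i\rho_j=\rho_j\rho_i$ for $|i-j|\ge 2$; (2) $\sigma_{i,t}\sigma_{j,\ell}=\sigma_{j,\ell}\sigma_{i,t}$ for $|i-j|\ge 2$ and all $1\le t,\ell\le k$; (3) $\sigma_{i,t}\rho_j=\rho_j\sigma_{i,t}$ for $|i-j|\ge 2$; (4) $\rho_i\rho_{i+1}\sigma_{i,t}=\sigma_{i+1,t}\rho_i\rho_{i+1}$ for $1\le i\le n-2$, $1\le t\le k$. For a family $R$ of relations $u=v$, $\langle\!\langle R\rangle\!\rangle$ denotes the normal closure of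 the elements $uv^{-1}$. *)

theory Defs
  imports "HOL-Algebra.Algebra"
begin

section \<open>Free groups\<close>

text \<open>A letter \<open>(x, True)\<close> stands for the generator \<open>x\<close>, and \<open>(x, False)\<close> for its formal inverse.
  The elements of the free group on \<open>S\<close> are the classes of words over \<open>S\<close> modulo insertion and
  deletion of adjacent mutually inverse letters.\<close>

type_synonym 'x word = "('x \<times> bool) list"

definition words :: "'x set \<Rightarrow> 'x word set" where
  "words S = lists (S \<times> UNIV)"

inductive free_eq :: "'x set \<Rightarrow> 'x word \<Rightarrow> 'x word \<Rightarrow> bool" for S where
  refl: "u \<in> words S \<Longrightarrow> free_eq S u u"
| sym: "free_eq S u v \<Longrightarrow> free_eq S v u"
| trans: "free_eq S u v \<Longrightarrow> free_eq S v w \<Longrightarrow> free_eq S u w"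
| cancel: "u \<in> words S \<Longrightarrow> v \<in> words S \<Longrightarrow> x \<in> S \<Longrightarrow>
    free_eq S (u @ [(x, b), (x, \<not> b)] @ v) (u @ v)"

definition word_class :: "'x set \<Rightarrow> 'x word \<Rightarrow> 'x word set" where
  "word_class S u = {v. free_eq S u v}"

definition free_group :: "'x set \<Rightarrow> 'x word set monoid" where
  "free_group S =
    \<lparr>carrier = word_class S ` words S,
     monoid.mult = (\<lambda>A B. \<Union>u\<in>A. \<Union>v\<in>B. word_class S (u @ v)),
     one = word_class S []\<rparr>"

definition free_gen :: "'x set \<Rightarrow> 'x \<Rightarrow> 'x word set" where
  "free_gen S x = word_class S [(x, True)]"

lemma free_eq_words: "free_eq S u v \<Longrightarrow> u \<in> words S \<and> v \<in> words S"
  by (induction rule: free_eq.induct) (auto simp: words_def)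

lemma words_append: "u \<in> words S \<Longrightarrow> v \<in> words S \<Longrightarrow> u @ v \<in> words S"
  by (simp add: words_def)

lemma free_eq_append_left:
  assumes "free_eq S u v" "w \<in> words S"
  shows "free_eq S (w @ u) (w @ v)"
  using assms
proof (induction rule: free_eq.induct)
  case (cancel u v x b)
  then have "w @ u \<in> words S" by (simp add: words_def)
  from free_eq.cancel[OF this cancel(2,3)] show ?case by simp
qed (auto intro: free_eq.intros simp: words_def)

lemma free_eq_append_right:
  assumes "free_eq S u v" "w \<in> words S"
  shows "free_eq S (u @ w) (v @ w)"
  using assms
proof (induction rule: free_eq.induct)
  case (cancel u v x b)
  then have "v @ w \<in> words S" by (simp add: words_def)
  from free_eq.cancel[OF cancel(1) this cancel(3)] show ?case by simp
qed (auto intro: free_eq.intros simp: words_def)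

lemma free_eq_append:
  "free_eq S u u' \<Longrightarrow> free_eq S v v' \<Longrightarrow> free_eq S (u @ v) (u' @ v')"
  by (meson free_eq.trans free_eq_append_left free_eq_append_right free_eq_words)

lemma word_class_eq_iff:
  assumes "u \<in> words S"
  shows "word_class S u = word_class S v \<longleftrightarrow> free_eq S u v"
  using assms unfolding word_class_def by (blast intro: free_eq.intros)

lemma carrier_free_group [simp]: "carrier (free_group S) = word_class S ` words S"
  and one_free_group [simp]: "\<one>\<^bsub>free_group S\<^esub> = word_class S []"
  by (simp_all add: free_group_def)

lemma mult_free_group [simp]:
  assumes "u \<in> words S" "v \<in> words S"
  shows "word_class S u \<otimes>\<^bsub>free_group S\<^esub> word_class S v = word_class S (u @ v)"
proof -
  have "word_class S (u' @ v') = word_class S (u @ v)"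
    if "u' \<in> word_class S u" "v' \<in> word_class S v" for u' v'
  proof -
    have "free_eq S (u @ v) (u' @ v')"
      using that by (intro free_eq_append) (auto simp: word_class_def)
    then show ?thesis
      using free_eq_words word_class_eq_iff by blast
  qed
  then have "word_class S u \<otimes>\<^bsub>free_group S\<^esub> word_class S v =
      (\<Union>u'\<in>word_class S u. \<Union>v'\<in>word_class S v. word_class S (u @ v))"
    by (simp add: free_group_def)
  moreover have "u \<in> word_class S u" "v \<in> word_class S v"
    using assms by (auto simp: word_class_def intro: free_eq.refl)
  ultimately show ?thesis
    by auto
qed

lemma free_eq_left_inverse:
  "u \<in> words S \<Longrightarrow> free_eq S (rev (map (\<lambda>(x, b). (x, \<not> b)) u) @ u) []"
proof (induction u)
  case Nil
  then show ?case by (simp add: free_eq.refl)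
next
  case (Cons a u)
  obtain x b where a: "a = (x, b)" by (cases a)
  let ?v = "rev (map (\<lambda>(x, b). (x, \<not> b)) u)"
  have u: "u \<in> words S" "x \<in> S" using Cons.prems a by (auto simp: words_def)
  then have "?v \<in> words S" by (auto simp: words_def)
  from free_eq.cancel[OF this u, of "\<not> b"]
  have "free_eq S (rev (map (\<lambda>(x, b). (x, \<not> b)) (a # u)) @ a # u) (?v @ u)"
    by (simp add: a)
  then show ?case using Cons.IH[OF u(1)] free_eq.trans by blast
qed

lemma group_free_group: "group (free_group S)"
proof (rule groupI)
  fix A assume "A \<in> carrier (free_group S)"
  then obtain u where u: "u \<in> words S" "A = word_class S u" by auto
  let ?v = "rev (map (\<lambda>(x, b). (x, \<not> b)) u)"
  have v: "?v \<in> words S" using u(1) by (auto simp: words_def)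
  moreover have "word_class S (?v @ u) = word_class S []"
    using u(1) v free_eq_left_inverse[of u S]
    by (subst word_class_eq_iff) (auto simp: words_def)
  ultimately show "\<exists>B\<in>carrier (free_group S). B \<otimes>\<^bsub>free_group S\<^esub> A = \<one>\<^bsub>free_group S\<^esub>"
    using u by auto
next
  show "\<one>\<^bsub>free_group S\<^esub> \<in> carrier (free_group S)"
    by (simp add: words_def)
next
  fix A B
  assume "A \<in> carrier (free_group S)" "B \<in> carrier (free_group S)"
  then show "A \<otimes>\<^bsub>free_group S\<^esub> B \<in> carrier (free_group S)"
    by (auto simp: words_append)
next
  fix A assume "A \<in> carrier (free_group S)"
  then obtain u where "u \<in> words S" "A = word_class S u" by auto
  moreover have "[] \<in> words S" by (simp add: words_def)
  ultimately show "\<one>\<^bsub>free_group S\<^esub> \<otimes>\<^bsub>free_group S\<^esub> A = A"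
    by simp
next
  fix A B C
  assume "A \<in> carrier (free_group S)" "B \<in> carrier (free_group S)" "C \<in> carrier (free_group S)"
  then obtain u v w where "u \<in> words S" "v \<in> words S" "w \<in> words S"
    "A = word_class S u" "B = word_class S v" "C = word_class S w"
    by auto
  moreover from this have "u @ v \<in> words S" "v @ w \<in> words S"
    by (auto simp: words_def)
  ultimately show "A \<otimes>\<^bsub>free_group S\<^esub> B \<otimes>\<^bsub>free_group S\<^esub> C =
      A \<otimes>\<^bsub>free_group S\<^esub> (B \<otimes>\<^bsub>free_group S\<^esub> C)"
    by simp
qed

lemma free_gen_closed: "x \<in> S \<Longrightarrow> free_gen S x \<in> carrier (free_group S)"
  unfolding free_gen_def carrier_free_group by (rule imageI) (simp add: words_def)


section \<open>Normal closures and quotients by families of relations\<close>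

definition normal_closure :: "('g, 'm) monoid_scheme \<Rightarrow> 'g set \<Rightarrow> 'g set" where
  "normal_closure G A =
    generate G {g \<otimes>\<^bsub>G\<^esub> a \<otimes>\<^bsub>G\<^esub> inv\<^bsub>G\<^esub> g | g a. g \<in> carrier G \<and> a \<in> A}"

text \<open>A relation \<open>u = v\<close> between elements of a group is encoded as the pair \<open>(u, v)\<close>.\<close>

definition relators :: "('g, 'm) monoid_scheme \<Rightarrow> ('g \<times> 'g) set \<Rightarrow> 'g set" where
  "relators G R = {u \<otimes>\<^bsub>G\<^esub> inv\<^bsub>G\<^esub> v | u v. (u, v) \<in> R}"

definition relation_quotient :: "('g, 'm) monoid_scheme \<Rightarrow> ('g \<times> 'g) set \<Rightarrow> 'g set monoid" where
  "relation_quotient G R = G Mod normal_closure G (relators G R)"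

definition quotient_map :: "('g, 'm) monoid_scheme \<Rightarrow> ('g \<times> 'g) set \<Rightarrow> 'g \<Rightarrow> 'g set" where
  "quotient_map G R g = normal_closure G (relators G R) #>\<^bsub>G\<^esub> g"

lemma (in group) normal_closure_normal:
  assumes "A \<subseteq> carrier G"
  shows "normal_closure G A \<lhd> G"
  unfolding normal_closure_def
proof (rule normal_generateI)
  show "{g \<otimes> a \<otimes> inv g | g a. g \<in> carrier G \<and> a \<in> A} \<subseteq> carrier G"
    using assms by auto
next
  fix h g
  assume "h \<in> {g \<otimes> a \<otimes> inv g | g a. g \<in> carrier G \<and> a \<in> A}" and g: "g \<in> carrier G"
  then obtain f a where h: "h = f \<otimes> a \<otimes> inv f" "f \<in> carrier G" "a \<in> A" by auto
  then have "a \<in> carrier G" using assms by auto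
  then have "g \<otimes> h \<otimes> inv g = (g \<otimes> f) \<otimes> a \<otimes> inv (g \<otimes> f)"
    using h g by (simp add: m_assoc inv_mult_group)
  then show "g \<otimes> h \<otimes> inv g \<in> {g \<otimes> a \<otimes> inv g | g a. g \<in> carrier G \<and> a \<in> A}"
    using g h by blast
qed

lemma (in group) relators_closed:
  "R \<subseteq> carrier G \<times> carrier G \<Longrightarrow> relators G R \<subseteq> carrier G"
  by (auto simp: relators_def)

lemma (in group) group_relation_quotient:
  "R \<subseteq> carrier G \<times> carrier G \<Longrightarrow> group (relation_quotient G R)"
  unfolding relation_quotient_def
  by (intro normal.factorgroup_is_group normal_closure_normal relators_closed)

lemma (in group) quotient_map_hom:
  assumes "R \<subseteq> carrier G \<times> carrier G"
  shows "quotient_map G R \<in> hom G (relation_quotient G R)"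
  using normal.r_coset_hom_Mod[OF normal_closure_normal[OF relators_closed[OF assms]]]
  unfolding relation_quotient_def quotient_map_def[abs_def] .


section \<open>The universal virtual braid group\<close>

datatype uv_gen = Rho nat | Sigma nat nat

definition uv_gens :: "nat \<Rightarrow> nat \<Rightarrow> uv_gen set" where
  "uv_gens n k = {Rho i | i. i \<in> {1..n - 1}} \<union> {Sigma i t | i t. i \<in> {1..n - 1} \<and> t \<in> {1..k}}"

definition uv_relations ::
  "('g, 'm) monoid_scheme \<Rightarrow> (nat \<Rightarrow> 'g) \<Rightarrow> (nat \<Rightarrow> nat \<Rightarrow> 'g) \<Rightarrow> nat \<Rightarrow> nat \<Rightarrow> ('g \<times> 'g) set" where
  "uv_relations G r s n k =
     {(r i \<otimes>\<^bsub>G\<^esub> r i, \<one>\<^bsub>G\<^esub>) | i. i \<in> {1..n - 1}}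
   \<union> {(r i \<otimes>\<^bsub>G\<^esub> r (i + 1) \<otimes>\<^bsub>G\<^esub> r i, r (i + 1) \<otimes>\<^bsub>G\<^esub> r i \<otimes>\<^bsub>G\<^esub> r (i + 1)) | i. i \<in> {1..n - 2}}
   \<union> {(r i \<otimes>\<^bsub>G\<^esub> r j, r j \<otimes>\<^bsub>G\<^esub> r i) | i j.
        i \<in> {1..n - 1} \<and> j \<in> {1..n - 1} \<and> \<bar>int i - int j\<bar> \<ge> 2}
   \<union> {(s i t \<otimes>\<^bsub>G\<^esub> s j l, s j l \<otimes>\<^bsub>G\<^esub> s i t) | i j t l.
        i \<in> {1..n - 1} \<and> j \<in> {1..n - 1} \<and> \<bar>int i - int j\<bar> \<ge> 2 \<and> t \<in> {1..k} \<and> l \<in> {1..k}}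
   \<union> {(s i t \<otimes>\<^bsub>G\<^esub> r j, r j \<otimes>\<^bsub>G\<^esub> s i t) | i j t.
        i \<in> {1..n - 1} \<and> j \<in> {1..n - 1} \<and> \<bar>int i - int j\<bar> \<ge> 2 \<and> t \<in> {1..k}}
   \<union> {(r i \<otimes>\<^bsub>G\<^esub> r (i + 1) \<otimes>\<^bsub>G\<^esub> s i t, s (i + 1) t \<otimes>\<^bsub>G\<^esub> r i \<otimes>\<^bsub>G\<^esub> r (i + 1)) | i t.
        i \<in> {1..n - 2} \<and> t \<in> {1..k}}"

definition uv_free_relations :: "nat \<Rightarrow> nat \<Rightarrow> (uv_gen word set \<times> uv_gen word set) set" where
  "uv_free_relations n k =
    uv_relations (free_group (uv_gens n k))
      (\<lambda>i. free_gen (uv_gens n k) (Rho i)) (\<lambda>i t. free_gen (uv_gens n k) (Sigma i t)) n k"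

definition UV :: "nat \<Rightarrow> nat \<Rightarrow> uv_gen word set set monoid" where
  "UV n k = relation_quotient (free_group (uv_gens n k)) (uv_free_relations n k)"

definition uv_elem :: "nat \<Rightarrow> nat \<Rightarrow> uv_gen \<Rightarrow> uv_gen word set set" where
  "uv_elem n k x =
    quotient_map (free_group (uv_gens n k)) (uv_free_relations n k) (free_gen (uv_gens n k) x)"

definition uv_rho :: "nat \<Rightarrow> nat \<Rightarrow> nat \<Rightarrow> uv_gen word set set" where
  "uv_rho n k i = uv_elem n k (Rho i)"

definition uv_sigma :: "nat \<Rightarrow> nat \<Rightarrow> nat \<Rightarrow> nat \<Rightarrow> uv_gen word set set" where
  "uv_sigma n k i t = uv_elem n k (Sigma i t)"

definition F1 :: "nat \<Rightarrow> nat \<Rightarrow> (uv_gen word set set \<times> uv_gen word set set) set" where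
  "F1 n k =
    {(uv_rho n k i \<otimes>\<^bsub>UV n k\<^esub> uv_sigma n k (i + 1) t \<otimes>\<^bsub>UV n k\<^esub> uv_sigma n k i t,
      uv_sigma n k (i + 1) t \<otimes>\<^bsub>UV n k\<^esub> uv_sigma n k i t \<otimes>\<^bsub>UV n k\<^esub> uv_rho n k (i + 1)) | i t.
     i \<in> {1..n - 2} \<and> t \<in> {1..k}}"

definition F2 :: "nat \<Rightarrow> nat \<Rightarrow> (uv_gen word set set \<times> uv_gen word set set) set" where
  "F2 n k =
    {(uv_rho n k (i + 1) \<otimes>\<^bsub>UV n k\<^esub> uv_sigma n k i t \<otimes>\<^bsub>UV n k\<^esub> uv_sigma n k (i + 1) t,
      uv_sigma n k i t \<otimes>\<^bsub>UV n k\<^esub> uv_sigma n k (i + 1) t \<otimes>\<^bsub>UV n k\<^esub> uv_rho n k i) | i t.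
     i \<in> {1..n - 2} \<and> t \<in> {1..k}}"

lemma (in group) uv_relations_closed:
  assumes r: "\<And>i. i \<in> {1..n - 1} \<Longrightarrow> r i \<in> carrier G"
    and s: "\<And>i t. i \<in> {1..n - 1} \<Longrightarrow> t \<in> {1..k} \<Longrightarrow> s i t \<in> carrier G"
  shows "uv_relations G r s n k \<subseteq> carrier G \<times> carrier G"
proof -
  have i: "i \<in> {1..n - 1} \<and> i + 1 \<in> {1..n - 1}" if "i \<in> {1..n - 2}" for i
    using that by auto
  show ?thesis
    unfolding uv_relations_def Un_subset_iff
    by (intro conjI subsetI; elim CollectE exE conjE)
      (use i in \<open>simp_all add: r s del: atLeastAtMost_iff One_nat_def Suc_eq_plus1 add_Suc_right\<close>)
qed

lemma uv_free_relations_closed: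
  "uv_free_relations n k \<subseteq> carrier (free_group (uv_gens n k)) \<times> carrier (free_group (uv_gens n k))"
  unfolding uv_free_relations_def
  by (intro group.uv_relations_closed group_free_group free_gen_closed) (auto simp: uv_gens_def)

lemma group_UV: "group (UV n k)"
  unfolding UV_def
  by (rule group.group_relation_quotient[OF group_free_group uv_free_relations_closed])

lemma uv_elem_closed:
  assumes "x \<in> uv_gens n k"
  shows "uv_elem n k x \<in> carrier (UV n k)"
  using group.quotient_map_hom[OF group_free_group uv_free_relations_closed] free_gen_closed[OF assms]
  unfolding UV_def uv_elem_def by (meson hom_in_carrier)

lemma uv_rho_closed: "i \<in> {1..n - 1} \<Longrightarrow> uv_rho n k i \<in> carrier (UV n k)"
  unfolding uv_rho_def by (rule uv_elem_closed) (auto simp: uv_gens_def)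

lemma uv_sigma_closed:
  "i \<in> {1..n - 1} \<Longrightarrow> t \<in> {1..k} \<Longrightarrow> uv_sigma n k i t \<in> carrier (UV n k)"
  unfolding uv_sigma_def by (rule uv_elem_closed) (auto simp: uv_gens_def)

lemma F1_closed: "F1 n k \<subseteq> carrier (UV n k) \<times> carrier (UV n k)"
proof -
  interpret group "UV n k" by (rule group_UV)
  show ?thesis
    unfolding F1_def by (auto intro!: m_closed uv_rho_closed uv_sigma_closed)
qed

lemma F2_closed: "F2 n k \<subseteq> carrier (UV n k) \<times> carrier (UV n k)"
proof -
  interpret group "UV n k" by (rule group_UV)
  show ?thesis
    unfolding F2_def by (auto intro!: m_closed uv_rho_closed uv_sigma_closed)
qed

definition Q1 :: "nat \<Rightarrow> nat \<Rightarrow> uv_gen word set set set monoid" where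
  "Q1 n k = relation_quotient (UV n k) (F1 n k)"

definition Q2 :: "nat \<Rightarrow> nat \<Rightarrow> uv_gen word set set set monoid" where
  "Q2 n k = relation_quotient (UV n k) (F2 n k)"

lemma group_Q1: "group (Q1 n k)"
  unfolding Q1_def by (rule group.group_relation_quotient[OF group_UV F1_closed])

lemma group_Q2: "group (Q2 n k)"
  unfolding Q2_def by (rule group.group_relation_quotient[OF group_UV F2_closed])

end

theory Submission
  imports Defs
begin

text \<open>
  Inverting all the \<open>\<sigma>\<close>'s turns one family of relations into the other. Write \<open>p, q\<close> for \<open>\<rho>\<close> with
  index \<open>i, i + 1\<close>, and \<open>x, y\<close> for \<open>\<sigma>\<close> with first index \<open>i + 1, i\<close> and second index \<open>t\<close>. Then
  \<open>F1\<close> says \<open>p x y = x y q\<close> and \<open>F2\<close> says \<open>q y x = y x p\<close>. Since \<open>p\<close> and \<open>q\<close> are involutions,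
  taking inverses on both sides of the first relation gives \<open>q (inv y) (inv x) = (inv y) (inv x) p\<close>,
  which is the second one for the inverted \<open>\<sigma>\<close>'s (\<open>inv_swap_relation\<close>).

  The substitution is realised by an automorphism of the universal virtual braid group. All its
  defining relations in which a \<open>\<sigma>\<close> occurs are commutations or say that one \<open>\<sigma>\<close> is a
  conjugate of another, and both kinds persist when each \<open>\<sigma>\<close> is replaced by its inverse
  (\<open>uv_relations_inv_sigma\<close>). The universal property (\<open>UV_hom_exists\<close>) then yields an
  endomorphism, which is an involution because its square fixes the generators
  (\<open>UV_inv_sigma_involution\<close>). An isomorphism whose two directions respect the relations of two
  quotients induces an isomorphism of the quotients (\<open>relation_quotient_iso\<close>).
\<close>

section \<open>Homomorphisms out of a free group\<close>

definition eval_word :: "('g, 'm) monoid_scheme \<Rightarrow> ('x \<Rightarrow> 'g) \<Rightarrow> 'x word \<Rightarrow> 'g" where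
  "eval_word G f u =
     foldr (\<lambda>(x, b) g. (if b then f x else inv\<^bsub>G\<^esub> f x) \<otimes>\<^bsub>G\<^esub> g) u \<one>\<^bsub>G\<^esub>"

lemma eval_word_Nil [simp]: "eval_word G f [] = \<one>\<^bsub>G\<^esub>"
  by (simp add: eval_word_def)

lemma eval_word_Cons [simp]:
  "eval_word G f ((x, b) # u) = (if b then f x else inv\<^bsub>G\<^esub> f x) \<otimes>\<^bsub>G\<^esub> eval_word G f u"
  by (simp add: eval_word_def)

lemma words_Nil [simp]: "[] \<in> words S"
  and words_Cons [simp]: "(x, b) # u \<in> words S \<longleftrightarrow> x \<in> S \<and> u \<in> words S"
  by (auto simp: words_def)

context group
begin

lemma eval_word_closed:
  assumes "f \<in> S \<rightarrow> carrier G" "u \<in> words S"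
  shows "eval_word G f u \<in> carrier G"
  using assms(2)
proof (induction u)
  case (Cons a u)
  then show ?case using assms(1) by (cases a) auto
qed simp

lemma eval_word_append:
  assumes f: "f \<in> S \<rightarrow> carrier G" and "u \<in> words S" and v: "v \<in> words S"
  shows "eval_word G f (u @ v) = eval_word G f u \<otimes> eval_word G f v"
  using assms(2)
proof (induction u)
  case Nil
  then show ?case using eval_word_closed[OF f v] by simp
next
  case (Cons a u)
  obtain x b where a: "a = (x, b)" by (cases a)
  then have "f x \<in> carrier G" "eval_word G f u \<in> carrier G" "eval_word G f v \<in> carrier G"
    using Cons.prems f v eval_word_closed[OF f] by auto
  then show ?case using Cons a by (simp add: m_assoc)
qed

lemma eval_word_free_eq:
  assumes f: "f \<in> S \<rightarrow> carrier G" and "free_eq S u v"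
  shows "eval_word G f u = eval_word G f v"
  using assms(2)
proof (induction rule: free_eq.induct)
  case (cancel u v x b)
  have x: "f x \<in> carrier G" using cancel f by auto
  have v: "eval_word G f v \<in> carrier G" by (rule eval_word_closed[OF f cancel(2)])
  have "eval_word G f ([(x, b), (x, \<not> b)] @ v) = eval_word G f v"
    using x v by (simp add: m_assoc[symmetric])
  moreover have "[(x, b), (x, \<not> b)] @ v \<in> words S" using cancel by simp
  ultimately show ?case using cancel by (simp add: eval_word_append[OF f] del: append_Cons)
qed simp_all

text \<open>Evaluation of words is constant on each class by \<open>eval_word_free_eq\<close>, so it descends to the
  free group.\<close>

lemma free_group_hom_exists:
  assumes f: "f \<in> S \<rightarrow> carrier G"
  obtains h where "h \<in> hom (free_group S) G" "\<And>x. x \<in> S \<Longrightarrow> h (free_gen S x) = f x"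
proof
  let ?h = "\<lambda>A. the_elem (eval_word G f ` A)"
  have h: "?h (word_class S u) = eval_word G f u" if u: "u \<in> words S" for u
  proof -
    have "u \<in> word_class S u" using u by (simp add: word_class_def free_eq.refl)
    moreover have "eval_word G f v = eval_word G f u" if "v \<in> word_class S u" for v
      using that eval_word_free_eq[OF f] by (simp add: word_class_def)
    ultimately have "eval_word G f ` word_class S u = {eval_word G f u}" by blast
    then show ?thesis by simp
  qed
  show "?h \<in> hom (free_group S) G"
    by (rule homI) (auto simp: h eval_word_closed[OF f] eval_word_append[OF f] words_append)
  show "?h (free_gen S x) = f x" if "x \<in> S" for x
  proof -
    have "f x \<in> carrier G" using f that by auto
    then show ?thesis using h[of "[(x, True)]"] that by (simp add: free_gen_def)
  qed
qed

lemma hom_word_class: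
  assumes h: "h \<in> hom (free_group S) G" and "u \<in> words S"
  shows "h (word_class S u) = eval_word G (\<lambda>x. h (free_gen S x)) u"
  using assms(2)
proof (induction u)
  interpret group_hom "free_group S" G h
    using h by (simp add: group_hom_def group_hom_axioms_def group_free_group is_group)
  {
    case Nil
    then show ?case using hom_one by simp
  next
    case (Cons a u)
    obtain x b where a: "a = (x, b)" by (cases a)
    have x: "x \<in> S" and u: "u \<in> words S" using Cons.prems a by auto
    have letter: "word_class S [(x, b)] =
        (if b then free_gen S x else inv\<^bsub>free_group S\<^esub> free_gen S x)"
    proof (cases b)
      case False
      have "free_eq S [(x, False), (x, True)] []"
        using free_eq.cancel[of "[]" S "[]" x False] x by simp
      then have "word_class S [(x, False)] \<otimes>\<^bsub>free_group S\<^esub> free_gen S x = \<one>\<^bsub>free_group S\<^esub>"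
        using x by (simp add: free_gen_def word_class_eq_iff)
      then have "inv\<^bsub>free_group S\<^esub> free_gen S x = word_class S [(x, False)]"
        using x free_gen_closed[OF x] by (intro group.inv_equality group_free_group) auto
      then show ?thesis using False by simp
    qed (simp add: free_gen_def)
    have "word_class S (a # u) = word_class S [(x, b)] \<otimes>\<^bsub>free_group S\<^esub> word_class S u"
      using x u by (simp add: a)
    moreover have "word_class S [(x, b)] \<in> carrier (free_group S)"
      "word_class S u \<in> carrier (free_group S)"
      using x u by auto
    ultimately have "h (word_class S (a # u)) = h (word_class S [(x, b)]) \<otimes> h (word_class S u)"
      by (simp only: hom_mult)
    then show ?case
      using Cons.IH[OF u] free_gen_closed[OF x] hom_inv[of "free_gen S x"] by (simp add: a letter)
  }
qed

lemma free_group_hom_unique: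
  assumes "g \<in> hom (free_group S) G" "h \<in> hom (free_group S) G"
    and eq: "\<And>x. x \<in> S \<Longrightarrow> g (free_gen S x) = h (free_gen S x)"
    and "A \<in> carrier (free_group S)"
  shows "g A = h A"
proof -
  obtain u where u: "u \<in> words S" "A = word_class S u" using assms(4) by auto
  have "eval_word G (\<lambda>x. g (free_gen S x)) u = eval_word G (\<lambda>x. h (free_gen S x)) u"
    using u(1)
  proof (induction u)
    case (Cons a u)
    then show ?case using eq by (cases a) simp
  qed simp
  then show ?thesis using assms(1,2) u by (simp add: hom_word_class)
qed

end

section \<open>Homomorphisms out of a quotient by relations\<close>

lemma carrier_relation_quotient:
  "carrier (relation_quotient G R) = quotient_map G R ` carrier G"
  by (auto simp: relation_quotient_def quotient_map_def FactGroup_def RCOSETS_def)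

lemma (in group) quotient_map_relation:
  assumes R: "R \<subseteq> carrier G \<times> carrier G" and uv: "(u, v) \<in> R"
  shows "quotient_map G R u = quotient_map G R v"
proof -
  let ?N = "normal_closure G (relators G R)"
  interpret N: normal ?N G by (rule normal_closure_normal[OF relators_closed[OF R]])
  have c: "u \<in> carrier G" "v \<in> carrier G" using R uv by auto
  have gen: "u \<otimes> inv v = \<one> \<otimes> (u \<otimes> inv v) \<otimes> inv \<one>" using c by simp
  have "u \<otimes> inv v \<in> relators G R" using uv by (auto simp: relators_def)
  then have "u \<otimes> inv v \<in> ?N"
    unfolding normal_closure_def by (intro generate.incl CollectI) (use gen in blast)
  then have "u \<otimes> inv v \<otimes> v \<in> ?N #> v" by (auto simp: r_coset_def)
  then have "u \<in> ?N #> v" using c by (simp add: m_assoc)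
  then show ?thesis
    unfolding quotient_map_def using repr_independence[OF _ c(2) N.is_subgroup] by blast
qed

text \<open>The hypothesis puts the relators, hence the normal closure they generate, into the kernel of
  \<open>h\<close>. So \<open>h\<close> is constant on each coset, and that constant value defines \<open>h'\<close>.\<close>

lemma (in group) relation_quotient_hom_exists:
  assumes R: "R \<subseteq> carrier G \<times> carrier G" and H: "group H" and h: "h \<in> hom G H"
    and eq: "\<And>u v. (u, v) \<in> R \<Longrightarrow> h u = h v"
  obtains h' where "h' \<in> hom (relation_quotient G R) H"
    "\<And>g. g \<in> carrier G \<Longrightarrow> h' (quotient_map G R g) = h g"
proof
  let ?N = "normal_closure G (relators G R)" and ?h = "\<lambda>A. the_elem (h ` A)"
  interpret h: group_hom G H h
    using h H by (simp add: group_hom_def group_hom_axioms_def is_group)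
  interpret N: normal ?N G by (rule normal_closure_normal[OF relators_closed[OF R]])
  have "h (u \<otimes> inv v) = \<one>\<^bsub>H\<^esub>" if "(u, v) \<in> R" for u v
    using R that eq[OF that] by auto
  then have "relators G R \<subseteq> kernel G H h"
    using R by (auto simp: relators_def kernel_def)
  then have "{g \<otimes> a \<otimes> inv g | g a. g \<in> carrier G \<and> a \<in> relators G R} \<subseteq> kernel G H h"
    by (auto simp: kernel_def)
  then have N_ker: "?N \<subseteq> kernel G H h"
    unfolding normal_closure_def using h.subgroup_kernel by (rule generate_subgroup_incl)
  show val: "?h (quotient_map G R g) = h g" if g: "g \<in> carrier G" for g
  proof -
    have "h (x \<otimes> g) = h g" if "x \<in> ?N" for x
      using N_ker that g by (auto simp: kernel_def)
    moreover have "?N \<noteq> {}" using N.one_closed by blast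
    ultimately have "h ` quotient_map G R g = {h g}"
      unfolding quotient_map_def r_coset_def by (auto simp: image_UN)
    then show ?thesis by simp
  qed
  show "?h \<in> hom (relation_quotient G R) H"
  proof (rule homI)
    fix A B assume "A \<in> carrier (relation_quotient G R)" "B \<in> carrier (relation_quotient G R)"
    then obtain x y where xy: "x \<in> carrier G" "y \<in> carrier G"
      "A = quotient_map G R x" "B = quotient_map G R y"
      by (auto simp: carrier_relation_quotient)
    then have "A \<otimes>\<^bsub>relation_quotient G R\<^esub> B = quotient_map G R (x \<otimes> y)"
      using quotient_map_hom[OF R] by (simp add: hom_mult)
    then show "?h (A \<otimes>\<^bsub>relation_quotient G R\<^esub> B) = ?h A \<otimes>\<^bsub>H\<^esub> ?h B"
      using xy by (simp add: val)
  qed (auto simp: carrier_relation_quotient val)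
qed

text \<open>Each composite with a projection factors through the other quotient, and the two induced
  maps are mutually inverse because the projections are surjective.\<close>

lemma relation_quotient_iso:
  assumes G: "group G" and H: "group H"
    and R: "R \<subseteq> carrier G \<times> carrier G" and S: "S \<subseteq> carrier H \<times> carrier H"
    and f: "f \<in> hom G H" and g: "g \<in> hom H G"
    and gf: "\<And>x. x \<in> carrier G \<Longrightarrow> g (f x) = x" and fg: "\<And>y. y \<in> carrier H \<Longrightarrow> f (g y) = y"
    and fR: "\<And>u v. (u, v) \<in> R \<Longrightarrow> quotient_map H S (f u) = quotient_map H S (f v)"
    and gS: "\<And>u v. (u, v) \<in> S \<Longrightarrow> quotient_map G R (g u) = quotient_map G R (g v)"
  shows "relation_quotient G R \<cong> relation_quotient H S"
proof -
  let ?p = "quotient_map G R" and ?q = "quotient_map H S"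
  interpret G: group G by (rule G)
  interpret H: group H by (rule H)
  have "?q \<circ> f \<in> hom G (relation_quotient H S)"
    by (rule hom_compose[OF f H.quotient_map_hom[OF S]])
  then obtain f' where f': "f' \<in> hom (relation_quotient G R) (relation_quotient H S)"
    "\<And>x. x \<in> carrier G \<Longrightarrow> f' (?p x) = ?q (f x)"
    using G.relation_quotient_hom_exists[OF R H.group_relation_quotient[OF S]] fR by (metis comp_apply)
  have "?p \<circ> g \<in> hom H (relation_quotient G R)"
    by (rule hom_compose[OF g G.quotient_map_hom[OF R]])
  then obtain g' where g': "g' \<in> hom (relation_quotient H S) (relation_quotient G R)"
    "\<And>y. y \<in> carrier H \<Longrightarrow> g' (?q y) = ?p (g y)"
    using H.relation_quotient_hom_exists[OF S G.group_relation_quotient[OF R]] gS by (metis comp_apply)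
  have "bij_betw f' (carrier (relation_quotient G R)) (carrier (relation_quotient H S))"
    using f' g' gf fg hom_in_carrier[OF f] hom_in_carrier[OF g]
    by (intro bij_betw_byWitness[of _ g']) (auto simp: carrier_relation_quotient)
  then show ?thesis using f'(1) by (auto simp: is_iso_def iso_def)
qed

section \<open>The universal property of the universal virtual braid group\<close>

lemma uv_relations_cases [consumes 1, case_names involution braid rho_rho sigma_sigma sigma_rho mixed]:
  assumes "(u, v) \<in> uv_relations G r s n k"
  obtains
    i where "i \<in> {1..n - 1}" "u = r i \<otimes>\<^bsub>G\<^esub> r i" "v = \<one>\<^bsub>G\<^esub>"
  | i where "i \<in> {1..n - 2}" "u = r i \<otimes>\<^bsub>G\<^esub> r (i + 1) \<otimes>\<^bsub>G\<^esub> r i"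
      "v = r (i + 1) \<otimes>\<^bsub>G\<^esub> r i \<otimes>\<^bsub>G\<^esub> r (i + 1)"
  | i j where "i \<in> {1..n - 1}" "j \<in> {1..n - 1}" "\<bar>int i - int j\<bar> \<ge> 2"
      "u = r i \<otimes>\<^bsub>G\<^esub> r j" "v = r j \<otimes>\<^bsub>G\<^esub> r i"
  | i j t l where "i \<in> {1..n - 1}" "j \<in> {1..n - 1}" "\<bar>int i - int j\<bar> \<ge> 2" "t \<in> {1..k}" "l \<in> {1..k}"
      "u = s i t \<otimes>\<^bsub>G\<^esub> s j l" "v = s j l \<otimes>\<^bsub>G\<^esub> s i t"
  | i j t where "i \<in> {1..n - 1}" "j \<in> {1..n - 1}" "\<bar>int i - int j\<bar> \<ge> 2" "t \<in> {1..k}"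
      "u = s i t \<otimes>\<^bsub>G\<^esub> r j" "v = r j \<otimes>\<^bsub>G\<^esub> s i t"
  | i t where "i \<in> {1..n - 2}" "t \<in> {1..k}" "u = r i \<otimes>\<^bsub>G\<^esub> r (i + 1) \<otimes>\<^bsub>G\<^esub> s i t"
      "v = s (i + 1) t \<otimes>\<^bsub>G\<^esub> r i \<otimes>\<^bsub>G\<^esub> r (i + 1)"
  using assms unfolding uv_relations_def by blast

lemma uv_relations_intros:
  shows "i \<in> {1..n - 1} \<Longrightarrow> (r i \<otimes>\<^bsub>G\<^esub> r i, \<one>\<^bsub>G\<^esub>) \<in> uv_relations G r s n k"
    and "i \<in> {1..n - 2} \<Longrightarrow> (r i \<otimes>\<^bsub>G\<^esub> r (i + 1) \<otimes>\<^bsub>G\<^esub> r i, r (i + 1) \<otimes>\<^bsub>G\<^esub> r i \<otimes>\<^bsub>G\<^esub> r (i + 1))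
      \<in> uv_relations G r s n k"
    and "i \<in> {1..n - 1} \<Longrightarrow> j \<in> {1..n - 1} \<Longrightarrow> \<bar>int i - int j\<bar> \<ge> 2 \<Longrightarrow>
      (r i \<otimes>\<^bsub>G\<^esub> r j, r j \<otimes>\<^bsub>G\<^esub> r i) \<in> uv_relations G r s n k"
    and "i \<in> {1..n - 1} \<Longrightarrow> j \<in> {1..n - 1} \<Longrightarrow> \<bar>int i - int j\<bar> \<ge> 2 \<Longrightarrow> t \<in> {1..k} \<Longrightarrow> l \<in> {1..k} \<Longrightarrow>
      (s i t \<otimes>\<^bsub>G\<^esub> s j l, s j l \<otimes>\<^bsub>G\<^esub> s i t) \<in> uv_relations G r s n k"
    and "i \<in> {1..n - 1} \<Longrightarrow> j \<in> {1..n - 1} \<Longrightarrow> \<bar>int i - int j\<bar> \<ge> 2 \<Longrightarrow> t \<in> {1..k} \<Longrightarrow>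
      (s i t \<otimes>\<^bsub>G\<^esub> r j, r j \<otimes>\<^bsub>G\<^esub> s i t) \<in> uv_relations G r s n k"
    and "i \<in> {1..n - 2} \<Longrightarrow> t \<in> {1..k} \<Longrightarrow>
      (r i \<otimes>\<^bsub>G\<^esub> r (i + 1) \<otimes>\<^bsub>G\<^esub> s i t, s (i + 1) t \<otimes>\<^bsub>G\<^esub> r i \<otimes>\<^bsub>G\<^esub> r (i + 1)) \<in> uv_relations G r s n k"
  unfolding uv_relations_def by blast+

lemma uv_relations_hom:
  assumes G: "group G" and H: "group H" and h: "h \<in> hom G H"
    and r: "\<And>i. i \<in> {1..n - 1} \<Longrightarrow> r i \<in> carrier G"
    and s: "\<And>i t. i \<in> {1..n - 1} \<Longrightarrow> t \<in> {1..k} \<Longrightarrow> s i t \<in> carrier G"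
    and hr: "\<And>i. i \<in> {1..n - 1} \<Longrightarrow> h (r i) = r' i"
    and hs: "\<And>i t. i \<in> {1..n - 1} \<Longrightarrow> t \<in> {1..k} \<Longrightarrow> h (s i t) = s' i t"
    and uv: "(u, v) \<in> uv_relations G r s n k"
  shows "(h u, h v) \<in> uv_relations H r' s' n k"
proof -
  interpret group_hom G H h
    using G H h by (simp add: group_hom_def group_hom_axioms_def)
  have idx: "i \<in> {1..n - 1}" "i + 1 \<in> {1..n - 1}" if "i \<in> {1..n - 2}" for i
    using that by auto
  note simps = r s hr hs idx
  from uv show ?thesis
  proof (cases rule: uv_relations_cases)
    case (involution i)
    then show ?thesis
      using uv_relations_intros(1)[where i=i and r=r' and s=s' and G=H and n=n and k=k]
      by (simp add: simps del: atLeastAtMost_iff)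
  next
    case (braid i)
    then show ?thesis
      using uv_relations_intros(2)[where i=i and r=r' and s=s' and G=H and n=n and k=k]
      by (simp add: simps del: atLeastAtMost_iff One_nat_def Suc_eq_plus1 add_Suc_right)
  next
    case (rho_rho i j)
    then show ?thesis
      using uv_relations_intros(3)[where i=i and j=j and r=r' and s=s' and G=H and n=n and k=k]
      by (simp add: simps del: atLeastAtMost_iff)
  next
    case (sigma_sigma i j t l)
    then show ?thesis
      using uv_relations_intros(4)[where i=i and j=j and t=t and l=l and r=r' and s=s' and G=H and n=n and k=k]
      by (simp add: simps del: atLeastAtMost_iff)
  next
    case (sigma_rho i j t)
    then show ?thesis
      using uv_relations_intros(5)[where i=i and j=j and t=t and r=r' and s=s' and G=H and n=n and k=k]
      by (simp add: simps del: atLeastAtMost_iff)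
  next
    case (mixed i t)
    then show ?thesis
      using uv_relations_intros(6)[where i=i and t=t and r=r' and s=s' and G=H and n=n and k=k]
      by (simp add: simps del: atLeastAtMost_iff One_nat_def Suc_eq_plus1 add_Suc_right)
  qed
qed

lemma uv_gens_iff [simp]:
  "Rho i \<in> uv_gens n k \<longleftrightarrow> i \<in> {1..n - 1}"
  "Sigma i t \<in> uv_gens n k \<longleftrightarrow> i \<in> {1..n - 1} \<and> t \<in> {1..k}"
  by (auto simp: uv_gens_def)

text \<open>The defining relations are imposed on the free generators; the projection carries them over to
  the images of these generators.\<close>

lemma UV_relations_hold:
  assumes "(u, v) \<in> uv_relations (UV n k) (uv_rho n k) (uv_sigma n k) n k"
  shows "u = v"
proof -
  let ?F = "free_group (uv_gens n k)"
    and ?q = "quotient_map (free_group (uv_gens n k)) (uv_free_relations n k)"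
  interpret F: group ?F by (rule group_free_group)
  have rel: "?q u = ?q v"
    if "(u, v) \<in> uv_relations ?F (\<lambda>i. free_gen (uv_gens n k) (Rho i))
      (\<lambda>i t. free_gen (uv_gens n k) (Sigma i t)) n k" for u v
    using that by (intro F.quotient_map_relation uv_free_relations_closed) (simp add: uv_free_relations_def)
  have hom: "?q \<in> hom ?F (UV n k)"
    unfolding UV_def by (rule F.quotient_map_hom[OF uv_free_relations_closed])
  interpret group_hom ?F "UV n k" ?q
    using hom by (simp add: group_hom_def group_hom_axioms_def group_UV group_free_group)
  have idx: "i \<in> {1..n - 1}" "i + 1 \<in> {1..n - 1}" if "i \<in> {1..n - 2}" for i
    using that by auto
  note simps = idx free_gen_closed uv_rho_def uv_sigma_def uv_elem_def
  from assms show ?thesis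
  proof (cases rule: uv_relations_cases)
    case (involution i)
    then show ?thesis using rel[OF uv_relations_intros(1)[where n=n and k=k and i=i]]
      by (simp add: simps del: atLeastAtMost_iff carrier_free_group one_free_group)
  next
    case (braid i)
    then show ?thesis using rel[OF uv_relations_intros(2)[where n=n and k=k and i=i]]
      by (simp add: simps del: atLeastAtMost_iff One_nat_def Suc_eq_plus1 add_Suc_right
          carrier_free_group one_free_group)
  next
    case (rho_rho i j)
    then show ?thesis using rel[OF uv_relations_intros(3)[where n=n and k=k and i=i and j=j]]
      by (simp add: simps del: atLeastAtMost_iff carrier_free_group one_free_group)
  next
    case (sigma_sigma i j t l)
    then show ?thesis using rel[OF uv_relations_intros(4)[where n=n and k=k and i=i and j=j and t=t and l=l]]
      by (simp add: simps del: atLeastAtMost_iff carrier_free_group one_free_group)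
  next
    case (sigma_rho i j t)
    then show ?thesis using rel[OF uv_relations_intros(5)[where n=n and k=k and i=i and j=j and t=t]]
      by (simp add: simps del: atLeastAtMost_iff carrier_free_group one_free_group)
  next
    case (mixed i t)
    then show ?thesis using rel[OF uv_relations_intros(6)[where n=n and k=k and i=i and t=t]]
      by (simp add: simps del: atLeastAtMost_iff One_nat_def Suc_eq_plus1 add_Suc_right
          carrier_free_group one_free_group)
  qed
qed

lemma UV_hom_exists:
  assumes G: "group G"
    and r: "\<And>i. i \<in> {1..n - 1} \<Longrightarrow> r i \<in> carrier G"
    and s: "\<And>i t. i \<in> {1..n - 1} \<Longrightarrow> t \<in> {1..k} \<Longrightarrow> s i t \<in> carrier G"
    and rel: "\<And>u v. (u, v) \<in> uv_relations G r s n k \<Longrightarrow> u = v"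
  obtains h where "h \<in> hom (UV n k) G"
    "\<And>i. i \<in> {1..n - 1} \<Longrightarrow> h (uv_rho n k i) = r i"
    "\<And>i t. i \<in> {1..n - 1} \<Longrightarrow> t \<in> {1..k} \<Longrightarrow> h (uv_sigma n k i t) = s i t"
proof -
  let ?S = "uv_gens n k"
  interpret F: group "free_group ?S" by (rule group_free_group)
  have "case_uv_gen r s \<in> ?S \<rightarrow> carrier G"
    using r s by (auto simp: uv_gens_def)
  from group.free_group_hom_exists[OF G this]
  obtain f where f: "f \<in> hom (free_group ?S) G"
    "\<And>x. x \<in> ?S \<Longrightarrow> f (free_gen ?S x) = case_uv_gen r s x"
    by blast
  have "f u = f v" if "(u, v) \<in> uv_free_relations n k" for u v
  proof (rule rel, rule uv_relations_hom[OF F.is_group G f(1)])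
    show "(u, v) \<in> uv_relations (free_group ?S) (\<lambda>i. free_gen ?S (Rho i)) (\<lambda>i t. free_gen ?S (Sigma i t)) n k"
      using that by (simp add: uv_free_relations_def)
  qed (use f(2) in \<open>simp_all add: free_gen_closed del: carrier_free_group\<close>)
  from F.relation_quotient_hom_exists[OF uv_free_relations_closed G f(1) this]
  obtain h where "h \<in> hom (UV n k) G"
    "\<And>x. x \<in> carrier (free_group ?S) \<Longrightarrow> h (quotient_map (free_group ?S) (uv_free_relations n k) x) = f x"
    unfolding UV_def by blast
  then show ?thesis
    using f(2) free_gen_closed[of _ ?S]
    by (intro that[of h]) (simp_all add: uv_rho_def uv_sigma_def uv_elem_def del: carrier_free_group)
qed

lemma UV_hom_unique:
  assumes G: "group G" and g: "g \<in> hom (UV n k) G" and h: "h \<in> hom (UV n k) G"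
    and rho: "\<And>i. i \<in> {1..n - 1} \<Longrightarrow> g (uv_rho n k i) = h (uv_rho n k i)"
    and sigma: "\<And>i t. i \<in> {1..n - 1} \<Longrightarrow> t \<in> {1..k} \<Longrightarrow> g (uv_sigma n k i t) = h (uv_sigma n k i t)"
    and x: "x \<in> carrier (UV n k)"
  shows "g x = h x"
proof -
  let ?F = "free_group (uv_gens n k)"
    and ?q = "quotient_map (free_group (uv_gens n k)) (uv_free_relations n k)"
  have q: "?q \<in> hom ?F (UV n k)"
    unfolding UV_def by (rule group.quotient_map_hom[OF group_free_group uv_free_relations_closed])
  obtain w where w: "w \<in> carrier ?F" "x = ?q w"
    using x unfolding UV_def carrier_relation_quotient by blast
  have "(g \<circ> ?q) w = (h \<circ> ?q) w"
  proof (rule group.free_group_hom_unique[OF G hom_compose[OF q g] hom_compose[OF q h] _ w(1)])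
    fix y assume "y \<in> uv_gens n k"
    then show "(g \<circ> ?q) (free_gen (uv_gens n k) y) = (h \<circ> ?q) (free_gen (uv_gens n k) y)"
      using rho sigma by (cases y) (simp_all add: uv_rho_def uv_sigma_def uv_elem_def)
  qed
  then show ?thesis using w by simp
qed

section \<open>Inverting the sigmas\<close>

context group
begin

lemma inv_commute:
  assumes "x \<in> carrier G" "y \<in> carrier G" "x \<otimes> y = y \<otimes> x"
  shows "inv x \<otimes> y = y \<otimes> inv x"
proof -
  have "inv x \<otimes> y = inv x \<otimes> (y \<otimes> x) \<otimes> inv x"
    using assms(1,2) by (simp add: m_assoc)
  also have "\<dots> = inv x \<otimes> (x \<otimes> y) \<otimes> inv x" by (simp only: assms(3))
  also have "\<dots> = y \<otimes> inv x"
    using assms(1,2) by (simp add: m_assoc[symmetric])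
  finally show ?thesis .
qed

lemma inv_intertwine:
  assumes c: "a \<in> carrier G" "x \<in> carrier G" "y \<in> carrier G" and "a \<otimes> x = y \<otimes> a"
  shows "a \<otimes> inv x = inv y \<otimes> a"
proof -
  have "a \<otimes> inv x = inv y \<otimes> (y \<otimes> a) \<otimes> inv x"
    using c by (simp add: m_assoc[symmetric])
  also have "\<dots> = inv y \<otimes> (a \<otimes> x) \<otimes> inv x" by (simp only: assms(4))
  also have "\<dots> = inv y \<otimes> a"
    using c by (simp add: m_assoc)
  finally show ?thesis .
qed

text \<open>The mixed relation says that conjugation by \<open>r i \<otimes> r (i + 1)\<close> takes \<open>s i t\<close> to
  \<open>s (i + 1) t\<close>, so it takes the inverse of the former to the inverse of the latter.\<close>

lemma uv_relations_inv_sigma: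
  assumes r: "\<And>i. i \<in> {1..n - 1} \<Longrightarrow> r i \<in> carrier G"
    and s: "\<And>i t. i \<in> {1..n - 1} \<Longrightarrow> t \<in> {1..k} \<Longrightarrow> s i t \<in> carrier G"
    and rel: "\<And>u v. (u, v) \<in> uv_relations G r s n k \<Longrightarrow> u = v"
    and "(u, v) \<in> uv_relations G r (\<lambda>i t. inv s i t) n k"
  shows "u = v"
  using assms(4)
proof (cases rule: uv_relations_cases)
  case (involution i)
  then show ?thesis using rel[OF uv_relations_intros(1)] by simp
next
  case (braid i)
  then show ?thesis using rel[OF uv_relations_intros(2)] by simp
next
  case (rho_rho i j)
  then show ?thesis using rel[OF uv_relations_intros(3)] by simp
next
  case (sigma_sigma i j t l)
  have c: "s i t \<in> carrier G" "s j l \<in> carrier G" using sigma_sigma s by auto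
  have "s i t \<otimes> s j l = s j l \<otimes> s i t"
    using sigma_sigma by (intro rel[OF uv_relations_intros(4)])
  then have "inv s i t \<otimes> s j l = s j l \<otimes> inv s i t" by (rule inv_commute[OF c])
  then have "inv s j l \<otimes> inv s i t = inv s i t \<otimes> inv s j l"
    using c by (intro inv_commute) auto
  then show ?thesis using sigma_sigma by simp
next
  case (sigma_rho i j t)
  then show ?thesis
    using rel[OF uv_relations_intros(5)] r s by (auto intro!: inv_commute)
next
  case (mixed i t)
  have c: "r i \<in> carrier G" "r (i + 1) \<in> carrier G" "s i t \<in> carrier G" "s (i + 1) t \<in> carrier G"
    using mixed r s by auto
  have "r i \<otimes> r (i + 1) \<otimes> s i t = s (i + 1) t \<otimes> r i \<otimes> r (i + 1)"
    using mixed by (intro rel[OF uv_relations_intros(6)])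
  then have "(r i \<otimes> r (i + 1)) \<otimes> s i t = s (i + 1) t \<otimes> (r i \<otimes> r (i + 1))"
    using c by (simp add: m_assoc)
  then have "(r i \<otimes> r (i + 1)) \<otimes> inv s i t = inv s (i + 1) t \<otimes> (r i \<otimes> r (i + 1))"
    using c by (intro inv_intertwine) auto
  then show ?thesis using mixed c by (simp add: m_assoc)
qed

text \<open>The two sides of the conclusion are the inverses of the two sides of the hypothesis, since
  \<open>p\<close> and \<open>q\<close> are involutions.\<close>

lemma inv_swap_relation:
  assumes c: "p \<in> carrier G" "q \<in> carrier G" "x \<in> carrier G" "y \<in> carrier G"
    and invol: "p \<otimes> p = \<one>" "q \<otimes> q = \<one>"
    and rel: "p \<otimes> x \<otimes> y = x \<otimes> y \<otimes> q"
  shows "q \<otimes> inv y \<otimes> inv x = inv y \<otimes> inv x \<otimes> p"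
proof -
  have "inv p = p" "inv q = q" using c invol by (simp_all add: inv_equality)
  then have "q \<otimes> inv y \<otimes> inv x = inv (x \<otimes> y \<otimes> q)"
    using c by (simp add: inv_mult_group m_assoc)
  also have "\<dots> = inv (p \<otimes> x \<otimes> y)" by (simp only: rel)
  also have "\<dots> = inv y \<otimes> inv x \<otimes> p"
    using c \<open>inv p = p\<close> by (simp add: inv_mult_group m_assoc)
  finally show ?thesis .
qed

end

text \<open>The square of the endomorphism that inverts the \<open>\<sigma>\<close>'s agrees with the identity on the
  generators, hence everywhere by \<open>UV_hom_unique\<close>.\<close>

lemma UV_inv_sigma_involution:
  obtains h where "h \<in> hom (UV n k) (UV n k)"
    "\<And>x. x \<in> carrier (UV n k) \<Longrightarrow> h (h x) = x"
    "\<And>i. i \<in> {1..n - 1} \<Longrightarrow> h (uv_rho n k i) = uv_rho n k i"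
    "\<And>i t. i \<in> {1..n - 1} \<Longrightarrow> t \<in> {1..k} \<Longrightarrow> h (uv_sigma n k i t) = inv\<^bsub>UV n k\<^esub> uv_sigma n k i t"
proof -
  interpret group "UV n k" by (rule group_UV)
  note closed = uv_rho_closed[of _ n k] uv_sigma_closed[of _ n _ k]
  have rel: "u = v"
    if "(u, v) \<in> uv_relations (UV n k) (uv_rho n k) (\<lambda>i t. inv\<^bsub>UV n k\<^esub> uv_sigma n k i t) n k" for u v
    by (rule uv_relations_inv_sigma[OF closed UV_relations_hold that])
  obtain h where h: "h \<in> hom (UV n k) (UV n k)"
    "\<And>i. i \<in> {1..n - 1} \<Longrightarrow> h (uv_rho n k i) = uv_rho n k i"
    "\<And>i t. i \<in> {1..n - 1} \<Longrightarrow> t \<in> {1..k} \<Longrightarrow> h (uv_sigma n k i t) = inv\<^bsub>UV n k\<^esub> uv_sigma n k i t"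
    using UV_hom_exists[OF is_group, of n "uv_rho n k" k "\<lambda>i t. inv\<^bsub>UV n k\<^esub> uv_sigma n k i t",
        OF closed(1) inv_closed[OF closed(2)] rel]
    by blast
  interpret h: group_hom "UV n k" "UV n k" h
    using h by (simp add: group_hom_def group_hom_axioms_def is_group)
  have comp: "(h \<circ> h) x = id x" if x: "x \<in> carrier (UV n k)" for x
  proof (rule UV_hom_unique[where g = "h \<circ> h" and h = id and n = n and k = k and G = "UV n k"])
    show "group (UV n k)" by (rule is_group)
    show "h \<circ> h \<in> hom (UV n k) (UV n k)" by (rule Group.hom_compose[OF h(1) h(1)])
    show "id \<in> hom (UV n k) (UV n k)" by (simp add: hom_def)
    show "x \<in> carrier (UV n k)" by (rule x)
  qed (use h closed in \<open>simp_all del: atLeastAtMost_iff\<close>)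
  have "h (h x) = x" if "x \<in> carrier (UV n k)" for x
    using comp[OF that] by simp
  then show ?thesis by (rule that[OF h(1) _ h(2) h(3)])
qed

theorem theorem3p1:
  fixes n k :: nat
  assumes "k \<ge> 1" and "n \<ge> 3"
  shows "Q1 n k \<cong> Q2 n k"
proof -
  obtain h where h: "h \<in> hom (UV n k) (UV n k)"
    "\<And>x. x \<in> carrier (UV n k) \<Longrightarrow> h (h x) = x"
    "\<And>i. i \<in> {1..n - 1} \<Longrightarrow> h (uv_rho n k i) = uv_rho n k i"
    "\<And>i t. i \<in> {1..n - 1} \<Longrightarrow> t \<in> {1..k} \<Longrightarrow> h (uv_sigma n k i t) = inv\<^bsub>UV n k\<^esub> uv_sigma n k i t"
    using UV_inv_sigma_involution[of n k] by blast
  interpret UV: group "UV n k" by (rule group_UV)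
  interpret h: group_hom "UV n k" "UV n k" h
    using h(1) by (simp add: group_hom_def group_hom_axioms_def UV.is_group)
  have rho_square: "uv_rho n k i \<otimes>\<^bsub>UV n k\<^esub> uv_rho n k i = \<one>\<^bsub>UV n k\<^esub>" if "i \<in> {1..n - 1}" for i
    by (rule UV_relations_hold[OF uv_relations_intros(1)[OF that]])
  \<comment> \<open>With \<open>(a, b, c, d) = (i, i + 1, i, i + 1)\<close> \<open>rel\<close> is \<open>q\<close> applied to a relation of \<open>F1\<close>,
    and the conclusion is \<open>q \<circ> h\<close> applied to one of \<open>F2\<close>. With \<open>(i + 1, i, i + 1, i)\<close> the two families
    are exchanged.\<close>
  have swap: "q (h (uv_rho n k d \<otimes>\<^bsub>UV n k\<^esub> uv_sigma n k c t \<otimes>\<^bsub>UV n k\<^esub> uv_sigma n k b t)) =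
      q (h (uv_sigma n k c t \<otimes>\<^bsub>UV n k\<^esub> uv_sigma n k b t \<otimes>\<^bsub>UV n k\<^esub> uv_rho n k a))"
    if H: "group H" and q: "q \<in> hom (UV n k) H"
      and idx: "a \<in> {1..n - 1}" "b \<in> {1..n - 1}" "c \<in> {1..n - 1}" "d \<in> {1..n - 1}" "t \<in> {1..k}"
      and rel: "q (uv_rho n k a \<otimes>\<^bsub>UV n k\<^esub> uv_sigma n k b t \<otimes>\<^bsub>UV n k\<^esub> uv_sigma n k c t) =
        q (uv_sigma n k b t \<otimes>\<^bsub>UV n k\<^esub> uv_sigma n k c t \<otimes>\<^bsub>UV n k\<^esub> uv_rho n k d)"
    for H :: "uv_gen word set set set monoid" and q a b c d t
  proof -
    interpret q: group_hom "UV n k" H q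
      using H q by (simp add: group_hom_def group_hom_axioms_def UV.is_group)
    note closed = uv_rho_closed[OF idx(1)] uv_rho_closed[OF idx(4)]
      uv_sigma_closed[OF idx(2,5)] uv_sigma_closed[OF idx(3,5)]
    have "q (uv_rho n k a) \<otimes>\<^bsub>H\<^esub> q (uv_rho n k a) = \<one>\<^bsub>H\<^esub>"
      "q (uv_rho n k d) \<otimes>\<^bsub>H\<^esub> q (uv_rho n k d) = \<one>\<^bsub>H\<^esub>"
      using rho_square[OF idx(1)] rho_square[OF idx(4)] closed by (simp_all flip: q.hom_mult)
    moreover have "q (uv_rho n k a) \<otimes>\<^bsub>H\<^esub> q (uv_sigma n k b t) \<otimes>\<^bsub>H\<^esub> q (uv_sigma n k c t) =
        q (uv_sigma n k b t) \<otimes>\<^bsub>H\<^esub> q (uv_sigma n k c t) \<otimes>\<^bsub>H\<^esub> q (uv_rho n k d)"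
      using rel closed by simp
    ultimately have "q (uv_rho n k d) \<otimes>\<^bsub>H\<^esub> inv\<^bsub>H\<^esub> q (uv_sigma n k c t) \<otimes>\<^bsub>H\<^esub> inv\<^bsub>H\<^esub> q (uv_sigma n k b t) =
        inv\<^bsub>H\<^esub> q (uv_sigma n k c t) \<otimes>\<^bsub>H\<^esub> inv\<^bsub>H\<^esub> q (uv_sigma n k b t) \<otimes>\<^bsub>H\<^esub> q (uv_rho n k a)"
      by (intro q.H.inv_swap_relation q.hom_closed closed)
    then show ?thesis
      using closed h(3)[OF idx(1)] h(3)[OF idx(4)] h(4)[OF idx(2,5)] h(4)[OF idx(3,5)] by simp
  qed
  have idx: "i \<in> {1..n - 1}" "i + 1 \<in> {1..n - 1}" if "i \<in> {1..n - 2}" for i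
    using that by auto
  show ?thesis
    unfolding Q1_def Q2_def
  proof (rule relation_quotient_iso[OF group_UV group_UV F1_closed F2_closed h(1) h(1) h(2) h(2)])
    fix u v assume "(u, v) \<in> F1 n k"
    then obtain i t where it: "i \<in> {1..n - 2}" "t \<in> {1..k}" and uv:
      "u = uv_rho n k i \<otimes>\<^bsub>UV n k\<^esub> uv_sigma n k (i + 1) t \<otimes>\<^bsub>UV n k\<^esub> uv_sigma n k i t"
      "v = uv_sigma n k (i + 1) t \<otimes>\<^bsub>UV n k\<^esub> uv_sigma n k i t \<otimes>\<^bsub>UV n k\<^esub> uv_rho n k (i + 1)"
      unfolding F1_def by blast
    show "quotient_map (UV n k) (F2 n k) (h u) = quotient_map (UV n k) (F2 n k) (h v)"
      unfolding uv
      using UV.group_relation_quotient[OF F2_closed] UV.quotient_map_hom[OF F2_closed]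
        idx(2)[OF it(1)] idx(1)[OF it(1)] idx(2)[OF it(1)] idx(1)[OF it(1)] it(2)
    proof (rule swap)
      show "quotient_map (UV n k) (F2 n k)
          (uv_rho n k (i + 1) \<otimes>\<^bsub>UV n k\<^esub> uv_sigma n k i t \<otimes>\<^bsub>UV n k\<^esub> uv_sigma n k (i + 1) t) =
        quotient_map (UV n k) (F2 n k)
          (uv_sigma n k i t \<otimes>\<^bsub>UV n k\<^esub> uv_sigma n k (i + 1) t \<otimes>\<^bsub>UV n k\<^esub> uv_rho n k i)"
        using it unfolding F2_def by (intro UV.quotient_map_relation[OF F2_closed, unfolded F2_def]) blast
    qed
  next
    fix u v assume "(u, v) \<in> F2 n k"
    then obtain i t where it: "i \<in> {1..n - 2}" "t \<in> {1..k}" and uv: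
      "u = uv_rho n k (i + 1) \<otimes>\<^bsub>UV n k\<^esub> uv_sigma n k i t \<otimes>\<^bsub>UV n k\<^esub> uv_sigma n k (i + 1) t"
      "v = uv_sigma n k i t \<otimes>\<^bsub>UV n k\<^esub> uv_sigma n k (i + 1) t \<otimes>\<^bsub>UV n k\<^esub> uv_rho n k i"
      unfolding F2_def by blast
    show "quotient_map (UV n k) (F1 n k) (h u) = quotient_map (UV n k) (F1 n k) (h v)"
      unfolding uv
      using UV.group_relation_quotient[OF F1_closed] UV.quotient_map_hom[OF F1_closed]
        idx(1)[OF it(1)] idx(2)[OF it(1)] idx(1)[OF it(1)] idx(2)[OF it(1)] it(2)
    proof (rule swap)
      show "quotient_map (UV n k) (F1 n k)
          (uv_rho n k i \<otimes>\<^bsub>UV n k\<^esub> uv_sigma n k (i + 1) t \<otimes>\<^bsub>UV n k\<^esub> uv_sigma n k i t) =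
        quotient_map (UV n k) (F1 n k)
          (uv_sigma n k (i + 1) t \<otimes>\<^bsub>UV n k\<^esub> uv_sigma n k i t \<otimes>\<^bsub>UV n k\<^esub> uv_rho n k (i + 1))"
        using it unfolding F1_def by (intro UV.quotient_map_relation[OF F1_closed, unfolded F1_def]) blast
    qed
  qed
qed

end
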